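(* Let $\overline{(\cdot)}$ be the continuation-and-garbage-passing (CGPS) translation from the calculus $\lambda\mathbf{J}^{\mathbf{mse}}$ into the untyped $\lambda$-calculus described in the context. For all terms $t,u$ of $\lambda\mathbf{J}^{\mathbf{mse}}$, if $t\rightarrow u$ in $\lambda\mathbf{J}^{\mathbf{mse}}$, then $\overline{t}\rightarrow^+_{\beta}\overline{u}$ (one or more $\beta$-steps) in the $\lambda$-calculus.
   Context: The calculus $\lambda\mathbf{J}^{\mathbf{mse}}$ has three syntactic classes: terms $t,u,v::= x\mid \lambda x.t\mid \{c\}$; co-terms $l::= []\mid u::l\mid (x)c$; commands $c::= t\,l$ (a term followed by a co-term). $\lambda x$ binds $x$ in $t$ and $(x)$ binds $x$ in $c$; expressions are taken up to renaming of bound variables and $[t/x]T$ is capture-avoiding substitution. Co-terms of the form $[]$ or $u::l$ are called evaluation contexts, ranged over by $E$. A value $V$ is a variable or a $\lambda$-abstraction. Append of co-terms is defined by $[]@l'=l'$, $(u::l)@l'=u::(l@l')$, $((x)\,t\,l)@l'=(x)\,t\,(l@l')$. The one-step reduction $\rightarrow$ is the closure under all term/co-term/command constructors of the rules: $(\beta)\ (\lambda x.t)(u::l)\rightarrow u\,((x)\,t\,l)$; $(\pi)\ \{t\,l\}\,E\rightarrow t\,(l@E)$; $(\sigma)\ t\,(x)c\rightarrow [t/x]c$; $(\mu)\ (x)\,x\,l\rightarrow l$ if $x$ is not free in $l$; $(\epsilon)\ \{t\,[]\}\rightarrow t$. Translation. Fix a closed $\lambda$-term $\mathsf{s}$ such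 that $\mathsf{s}\,G\rightarrow^+_\beta G$ for every $G$ (e.g. $\mathsf{s}=\lambda z.z$), and write $G^+:=\mathsf{s}\,G$. Write $[t;u]:=(\lambda y.t)u$ with $y$ not free in $t$. For every expression $T$ of $\lambda\mathbf{J}^{\mathbf{mse}}$ and $\lambda$-terms $G,K$ define the $\lambda$-term $(T:G,K)$ by (with $w,m$ fresh variables): $(x:G,K)=x\,G^+\,K$; $(\lambda x.t:G,K)=[K(\lambda w x.w\,\overline{t});G]$; $(\{c\}:G,K)=(c:G^+,K)$; $([]:G,K)=\lambda w.w\,G\,K$; $(u::l:G,K)=\lambda w.w\,G\,(\lambda m.m\,(l:G,K)\,\overline{u})$; $((x)c:G,K)=\lambda x.(c:G,K)$; $(t\,[]:G,K)=(t:G,K)$; $(t\,(u::l):G,K)=(t:G,\lambda m.m\,(l:G,K)\,\overline{u})$; $(t\,(x)c:G,K)=((x)c:G,K)\,\overline{t}$; and $\overline{t}=\lambda g k.(t:g,k)$ with $g,k$ fresh. *)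

theory Defs
  imports Main
begin

text \<open>Both calculi are represented with de Bruijn indices, so that syntactic equality is equality up
  to renaming of bound variables; index \<open>i\<close> under \<open>k \<le> i\<close> binders denotes the free variable \<open>i - k\<close>.
  \<open>lift k\<close> opens a gap at index \<open>k\<close>; freshness of a binder for an
  expression is expressed by lifting that expression underneath the binder.\<close>


section \<open>The untyped lambda-calculus\<close>

datatype lam = LVar nat | LApp lam lam | LAbs lam

fun fv :: "lam \<Rightarrow> nat set" where
  "fv (LVar i) = {i}"
| "fv (LApp a b) = fv a \<union> fv b"
| "fv (LAbs a) = {i. Suc i \<in> fv a}"

definition closed_lam :: "lam \<Rightarrow> bool" where
  "closed_lam a \<longleftrightarrow> fv a = {}"

fun lift :: "nat \<Rightarrow> lam \<Rightarrow> lam" where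
  "lift k (LVar i) = LVar (if i < k then i else Suc i)"
| "lift k (LApp a b) = LApp (lift k a) (lift k b)"
| "lift k (LAbs a) = LAbs (lift (Suc k) a)"

text \<open>\<open>subst k b a\<close> replaces index \<open>k\<close> in \<open>a\<close> by \<open>b\<close> and lowers all indices above \<open>k\<close>.\<close>

fun subst :: "nat \<Rightarrow> lam \<Rightarrow> lam \<Rightarrow> lam" where
  "subst k b (LVar i) = (if i < k then LVar i else if i = k then b else LVar (i - 1))"
| "subst k b (LApp a1 a2) = LApp (subst k b a1) (subst k b a2)"
| "subst k b (LAbs a) = LAbs (subst (Suc k) (lift 0 b) a)"

inductive beta :: "lam \<Rightarrow> lam \<Rightarrow> bool" where
  "beta (LApp (LAbs a) b) (subst 0 b a)"
| "beta a a' \<Longrightarrow> beta (LApp a b) (LApp a' b)"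
| "beta b b' \<Longrightarrow> beta (LApp a b) (LApp a b')"
| "beta a a' \<Longrightarrow> beta (LAbs a) (LAbs a')"


section \<open>The calculus \<open>\<lambda>\<^bold>J\<^sup>m\<^sup>s\<^sup>e\<close>\<close>

text \<open>\<open>Cmd c\<close> is \<open>{c}\<close>; \<open>Emp\<close>, \<open>Push u l\<close>, \<open>Sel c\<close> are \<open>[]\<close>, \<open>u::l\<close>, \<open>(x)c\<close>; \<open>Cut t l\<close> is \<open>t l\<close>.
  \<open>Lam\<close> and \<open>Sel\<close> bind index \<open>0\<close>.\<close>

datatype tm = Var nat | Lam tm | Cmd cmd
     and cotm = Emp | Push tm cotm | Sel cmd
     and cmd = Cut tm cotm

primrec lift_tm :: "nat \<Rightarrow> tm \<Rightarrow> tm"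
    and lift_cotm :: "nat \<Rightarrow> cotm \<Rightarrow> cotm"
    and lift_cmd :: "nat \<Rightarrow> cmd \<Rightarrow> cmd" where
  "lift_tm k (Var i) = Var (if i < k then i else Suc i)"
| "lift_tm k (Lam t) = Lam (lift_tm (Suc k) t)"
| "lift_tm k (Cmd c) = Cmd (lift_cmd k c)"
| "lift_cotm k Emp = Emp"
| "lift_cotm k (Push u l) = Push (lift_tm k u) (lift_cotm k l)"
| "lift_cotm k (Sel c) = Sel (lift_cmd (Suc k) c)"
| "lift_cmd k (Cut t l) = Cut (lift_tm k t) (lift_cotm k l)"

primrec subst_tm :: "nat \<Rightarrow> tm \<Rightarrow> tm \<Rightarrow> tm"
    and subst_cotm :: "nat \<Rightarrow> tm \<Rightarrow> cotm \<Rightarrow> cotm"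
    and subst_cmd :: "nat \<Rightarrow> tm \<Rightarrow> cmd \<Rightarrow> cmd" where
  "subst_tm k v (Var i) = (if i < k then Var i else if i = k then v else Var (i - 1))"
| "subst_tm k v (Lam t) = Lam (subst_tm (Suc k) (lift_tm 0 v) t)"
| "subst_tm k v (Cmd c) = Cmd (subst_cmd k v c)"
| "subst_cotm k v Emp = Emp"
| "subst_cotm k v (Push u l) = Push (subst_tm k v u) (subst_cotm k v l)"
| "subst_cotm k v (Sel c) = Sel (subst_cmd (Suc k) (lift_tm 0 v) c)"
| "subst_cmd k v (Cut t l) = Cut (subst_tm k v t) (subst_cotm k v l)"

fun append_cotm :: "cotm \<Rightarrow> cotm \<Rightarrow> cotm" where
  "append_cotm Emp l' = l'"
| "append_cotm (Push u l) l' = Push u (append_cotm l l')"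
| "append_cotm (Sel (Cut t l)) l' = Sel (Cut t (append_cotm l (lift_cotm 0 l')))"

fun eval_context :: "cotm \<Rightarrow> bool" where
  "eval_context Emp = True"
| "eval_context (Push u l) = True"
| "eval_context (Sel c) = False"

text \<open>In rule \<open>mu\<close>, a co-term in the scope of \<open>(x)\<close> does not contain \<open>x\<close> free iff it is of the form
  \<open>lift_cotm 0 l\<close>, and \<open>l\<close> is then that same co-term outside the scope of \<open>(x)\<close>.\<close>

inductive red_tm :: "tm \<Rightarrow> tm \<Rightarrow> bool"
      and red_cotm :: "cotm \<Rightarrow> cotm \<Rightarrow> bool"
      and red_cmd :: "cmd \<Rightarrow> cmd \<Rightarrow> bool" where
  beta: "red_cmd (Cut (Lam t) (Push u l)) (Cut u (Sel (Cut t (lift_cotm 0 l))))"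
| pi: "eval_context E \<Longrightarrow> red_cmd (Cut (Cmd (Cut t l)) E) (Cut t (append_cotm l E))"
| sigma: "red_cmd (Cut t (Sel c)) (subst_cmd 0 t c)"
| mu: "red_cotm (Sel (Cut (Var 0) (lift_cotm 0 l))) l"
| epsilon: "red_tm (Cmd (Cut t Emp)) t"
| Lam: "red_tm t t' \<Longrightarrow> red_tm (Lam t) (Lam t')"
| Cmd: "red_cmd c c' \<Longrightarrow> red_tm (Cmd c) (Cmd c')"
| Push1: "red_tm u u' \<Longrightarrow> red_cotm (Push u l) (Push u' l)"
| Push2: "red_cotm l l' \<Longrightarrow> red_cotm (Push u l) (Push u l')"
| Sel: "red_cmd c c' \<Longrightarrow> red_cotm (Sel c) (Sel c')"
| Cut1: "red_tm t t' \<Longrightarrow> red_cmd (Cut t l) (Cut t' l)"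
| Cut2: "red_cotm l l' \<Longrightarrow> red_cmd (Cut t l) (Cut t l')"


section \<open>The continuation-and-garbage-passing translation\<close>

definition seq :: "lam \<Rightarrow> lam \<Rightarrow> lam" where
  "seq a b = LApp (LAbs (lift 0 a)) b"

text \<open>\<open>push_k L U\<close> is \<open>\<lambda>m. m L U\<close> with \<open>m\<close> fresh.\<close>

definition push_k :: "lam \<Rightarrow> lam \<Rightarrow> lam" where
  "push_k L U = LAbs (LApp (LApp (LVar 0) (lift 0 L)) (lift 0 U))"

lemma size_lift [simp]:
  "size (lift_tm k t) = size t"
  "size (lift_cotm k l) = size l"
  "size (lift_cmd k c) = size c"
  by (induction t and l and c arbitrary: k and k and k) auto

text \<open>The parameter \<open>s\<close> is the fixed term used in \<open>G\<^sup>+ = s G\<close>; it is not lifted under binders because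
  it is intended to be closed.  In the clause for \<open>Lam t\<close>, the term \<open>bar s t\<close> has the bound variable
  \<open>x\<close> at index \<open>0\<close>, and the extra binder \<open>w\<close> is inserted just outside it, at index \<open>1\<close>.\<close>

function trans_tm :: "lam \<Rightarrow> tm \<Rightarrow> lam \<Rightarrow> lam \<Rightarrow> lam"
     and trans_cotm :: "lam \<Rightarrow> cotm \<Rightarrow> lam \<Rightarrow> lam \<Rightarrow> lam"
     and trans_cmd :: "lam \<Rightarrow> cmd \<Rightarrow> lam \<Rightarrow> lam \<Rightarrow> lam"
     and bar :: "lam \<Rightarrow> tm \<Rightarrow> lam" where
  "trans_tm s (Var i) G K = LApp (LApp (LVar i) (LApp s G)) K"
| "trans_tm s (Lam t) G K =
     seq (LApp K (LAbs (LAbs (LApp (LVar 1) (lift 1 (bar s t)))))) G"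
| "trans_tm s (Cmd c) G K = trans_cmd s c (LApp s G) K"
| "trans_cotm s Emp G K = LAbs (LApp (LApp (LVar 0) (lift 0 G)) (lift 0 K))"
| "trans_cotm s (Push u l) G K =
     LAbs (LApp (LApp (LVar 0) (lift 0 G)) (lift 0 (push_k (trans_cotm s l G K) (bar s u))))"
| "trans_cotm s (Sel c) G K = LAbs (trans_cmd s c (lift 0 G) (lift 0 K))"
| "trans_cmd s (Cut t Emp) G K = trans_tm s t G K"
| "trans_cmd s (Cut t (Push u l)) G K = trans_tm s t G (push_k (trans_cotm s l G K) (bar s u))"
| "trans_cmd s (Cut t (Sel c)) G K = LApp (trans_cotm s (Sel c) G K) (bar s t)"
| "bar s t = LAbs (LAbs (trans_tm s (lift_tm 0 (lift_tm 0 t)) (LVar 1) (LVar 0)))"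
  by pat_completeness auto
termination
  by (relation "measure (case_sum
        (case_sum (\<lambda>(s, t, G, K). 2 * size t) (\<lambda>(s, l, G, K). 2 * size l))
        (case_sum (\<lambda>(s, c, G, K). 2 * size c) (\<lambda>(s, t). 2 * size t + 1)))") auto

end

theory Submission
  imports Defs
begin

text \<open>Every clause of the translation keeps the garbage and the continuation, so \<open>(T:G,K)\<close> is
  strictly monotone in both.  Hence replacing \<open>G\<^sup>+\<close> by \<open>G\<close> always costs at least one step, and this
  is what pays for the rules \<open>\<pi>\<close>, \<open>\<epsilon>\<close> and, when \<open>l\<close> is an evaluation context, \<open>\<mu>\<close>, in which no
  other redex need be contracted.  The rule \<open>\<sigma>\<close> (and \<open>\<mu>\<close> for \<open>l = (y)c\<close>, which is an instance of it
  under the binder) contracts one redex and then uses that substituting the translation of \<open>v\<close> for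
  \<open>x\<close> reduces to translating \<open>[v/x]T\<close>.  The rule \<open>\<beta>\<close> is simulated by administrative steps.  A \<open>\<mu>\<close>-step
  can change the clause that applies to an enclosing cut; the reduction of \<open>(l:G,K)\<close> applied to the
  translation of \<open>t\<close> to \<open>(t l:G,K)\<close> repairs this.\<close>

section \<open>Lifting and substitution\<close>

lemma lift_lift: "i \<le> k \<Longrightarrow> lift (Suc k) (lift i a) = lift i (lift k a)"
  by (induction a arbitrary: i k) auto

lemma subst_lift [simp]: "subst k b (lift k a) = a"
  by (induction a arbitrary: k b) auto

lemma lift_subst: "j \<le> k \<Longrightarrow> lift k (subst j b a) = subst j (lift k b) (lift (Suc k) a)"
  by (induction a arbitrary: j k b) (auto simp: lift_lift)

lemma subst_lift_commute:
  "j \<le> k \<Longrightarrow> subst (Suc k) (lift j b) (lift j a) = lift j (subst k b a)"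
  by (induction a arbitrary: j k b) (auto simp: lift_lift[symmetric])

lemma lift_fresh: "(\<And>i. i \<in> fv a \<Longrightarrow> i < k) \<Longrightarrow> lift k a = a"
proof (induction a arbitrary: k)
  case (LAbs a)
  have "i < Suc k" if "i \<in> fv a" for i
    using that LAbs.prems by (cases i) auto
  then show ?case using LAbs.IH by simp
qed auto

lemma lift_closed [simp]: "closed_lam s \<Longrightarrow> lift k s = s"
  by (rule lift_fresh) (simp add: closed_lam_def)

lemma subst_closed [simp]: "closed_lam s \<Longrightarrow> subst k b s = s"
  by (metis lift_closed subst_lift)

section \<open>Lifting and substitution in the source calculus\<close>

lemma lift_lift_jmse:
  "i \<le> k \<Longrightarrow> lift_tm (Suc k) (lift_tm i t) = lift_tm i (lift_tm k t)"
  "i \<le> k \<Longrightarrow> lift_cotm (Suc k) (lift_cotm i l) = lift_cotm i (lift_cotm k l)"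
  "i \<le> k \<Longrightarrow> lift_cmd (Suc k) (lift_cmd i c) = lift_cmd i (lift_cmd k c)"
  by (induction t and l and c arbitrary: i k and i k and i k) auto

text \<open>Serves \<open>mu\<close> for \<open>l = (y)c\<close>: there contracting the inner
  \<open>sigma\<close>-redex substitutes a variable for itself.\<close>

lemma subst_Var_lift:
  "subst_tm k (Var k) (lift_tm (Suc k) t) = t"
  "subst_cotm k (Var k) (lift_cotm (Suc k) l) = l"
  "subst_cmd k (Var k) (lift_cmd (Suc k) c) = c"
  by (induction t and l and c arbitrary: k and k and k) auto

lemma lift_subst_jmse:
  "j \<le> k \<Longrightarrow> lift_tm k (subst_tm j v t) = subst_tm j (lift_tm k v) (lift_tm (Suc k) t)"
  "j \<le> k \<Longrightarrow> lift_cotm k (subst_cotm j v l) = subst_cotm j (lift_tm k v) (lift_cotm (Suc k) l)"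
  "j \<le> k \<Longrightarrow> lift_cmd k (subst_cmd j v c) = subst_cmd j (lift_tm k v) (lift_cmd (Suc k) c)"
  by (induction t and l and c arbitrary: j k v and j k v and j k v)
    (auto simp: lift_lift_jmse)

lemma subst_lift_commute_jmse:
  "j \<le> k \<Longrightarrow> subst_tm (Suc k) (lift_tm j v) (lift_tm j t) = lift_tm j (subst_tm k v t)"
  "j \<le> k \<Longrightarrow> subst_cotm (Suc k) (lift_tm j v) (lift_cotm j l) = lift_cotm j (subst_cotm k v l)"
  "j \<le> k \<Longrightarrow> subst_cmd (Suc k) (lift_tm j v) (lift_cmd j c) = lift_cmd j (subst_cmd k v c)"
  by (induction t and l and c arbitrary: j k v and j k v and j k v)
    (auto simp: lift_lift_jmse[symmetric])

lemma lift_append_cotm: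
  "lift_cotm k (append_cotm l l') = append_cotm (lift_cotm k l) (lift_cotm k l')"
  by (induction l l' arbitrary: k rule: append_cotm.induct) (auto simp: lift_lift_jmse)

lemma eval_context_lift [simp]: "eval_context (lift_cotm k l) = eval_context l"
  by (cases l) auto

text \<open>Needed because \<open>bar s t\<close> translates \<open>t\<close> only after lifting it
  twice.\<close>

lemma red_lift:
  "red_tm t t' \<Longrightarrow> red_tm (lift_tm k t) (lift_tm k t')"
  "red_cotm l l' \<Longrightarrow> red_cotm (lift_cotm k l) (lift_cotm k l')"
  "red_cmd c c' \<Longrightarrow> red_cmd (lift_cmd k c) (lift_cmd k c')"
proof (induction arbitrary: k and k and k rule: red_tm_red_cotm_red_cmd.inducts)
  case (beta t u l)
  show ?case
    using red_tm_red_cotm_red_cmd.beta[of "lift_tm (Suc k) t" "lift_tm k u" "lift_cotm k l"]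
    by (simp add: lift_lift_jmse)
next
  case (mu l)
  show ?case
    using red_tm_red_cotm_red_cmd.mu[of "lift_cotm k l"] by (simp add: lift_lift_jmse)
qed (auto simp: lift_append_cotm lift_subst_jmse intro: red_tm_red_cotm_red_cmd.intros)


section \<open>Reduction in contexts\<close>

lemma tranclp_map:
  assumes "\<And>x y. r x y \<Longrightarrow> r (f x) (f y)" and "r\<^sup>+\<^sup>+ a b"
  shows "r\<^sup>+\<^sup>+ (f a) (f b)"
  using assms(2) by induction (auto intro: assms(1) tranclp.trancl_into_trancl)

text \<open>The premise speaks of \<open>r\<^sup>+\<^sup>+\<close> because a translation may contain
  \<open>G\<close> several times, so that one step in \<open>G\<close> becomes several.\<close>

lemma rtranclp_map:
  assumes "\<And>x y. r\<^sup>+\<^sup>+ x y \<Longrightarrow> r\<^sup>+\<^sup>+ (f x) (f y)" and "r\<^sup>*\<^sup>* a b"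
  shows "r\<^sup>*\<^sup>* (f a) (f b)"
  using assms by (metis rtranclpD rtranclp.rtrancl_refl tranclp_into_rtranclp)

lemma beta_lift: "beta a b \<Longrightarrow> beta (lift k a) (lift k b)"
  by (induction arbitrary: k rule: beta.induct) (auto simp: lift_subst intro: beta.intros)

lemma tranclp_beta_cong:
  assumes "beta\<^sup>+\<^sup>+ a b"
  shows "beta\<^sup>+\<^sup>+ (LApp a c) (LApp b c)" "beta\<^sup>+\<^sup>+ (LApp c a) (LApp c b)"
    "beta\<^sup>+\<^sup>+ (LAbs a) (LAbs b)" "beta\<^sup>+\<^sup>+ (lift k a) (lift k b)"
  by (rule tranclp_map[OF _ assms]; simp add: beta.intros beta_lift)+

lemma rtranclp_beta_cong:
  assumes "beta\<^sup>*\<^sup>* a b"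
  shows "beta\<^sup>*\<^sup>* (LApp a c) (LApp b c)" "beta\<^sup>*\<^sup>* (LApp c a) (LApp c b)"
    "beta\<^sup>*\<^sup>* (LAbs a) (LAbs b)" "beta\<^sup>*\<^sup>* (lift k a) (lift k b)"
  by (rule rtranclp_map[OF _ assms]; simp add: tranclp_beta_cong)+

lemma rtranclp_beta_LApp:
  "beta\<^sup>*\<^sup>* a a' \<Longrightarrow> beta\<^sup>*\<^sup>* b b' \<Longrightarrow> beta\<^sup>*\<^sup>* (LApp a b) (LApp a' b')"
  by (meson rtranclp_beta_cong(1,2) rtranclp_trans)

lemma tranclp_beta_LApp:
  "beta\<^sup>+\<^sup>+ a a' \<Longrightarrow> beta\<^sup>+\<^sup>+ b b' \<Longrightarrow> beta\<^sup>+\<^sup>+ (LApp a b) (LApp a' b')"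
  by (meson tranclp_beta_cong(1,2) tranclp_trans)

section \<open>The derived forms \<open>push_k\<close> and \<open>seq\<close>\<close>

lemma tranclp_beta_push_k:
  "beta\<^sup>+\<^sup>+ a a' \<Longrightarrow> beta\<^sup>+\<^sup>+ (push_k a b) (push_k a' b)"
  "beta\<^sup>+\<^sup>+ b b' \<Longrightarrow> beta\<^sup>+\<^sup>+ (push_k a b) (push_k a b')"
  by (auto simp: push_k_def intro!: tranclp_beta_cong)

lemma rtranclp_beta_push_k:
  "beta\<^sup>*\<^sup>* a a' \<Longrightarrow> beta\<^sup>*\<^sup>* b b' \<Longrightarrow> beta\<^sup>*\<^sup>* (push_k a b) (push_k a' b')"
  by (auto simp: push_k_def intro!: rtranclp_beta_cong rtranclp_beta_LApp)

lemma lift_push_k: "lift k (push_k a b) = push_k (lift k a) (lift k b)"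
  by (simp add: push_k_def lift_lift)

lemma subst_push_k: "subst k v (push_k a b) = push_k (subst k v a) (subst k v b)"
  by (simp add: push_k_def subst_lift_commute)

lemma lift_seq: "lift k (seq a b) = seq (lift k a) (lift k b)"
  by (simp add: seq_def lift_lift)

lemma subst_seq: "subst k v (seq a b) = seq (subst k v a) (subst k v b)"
  by (simp add: seq_def subst_lift_commute)

lemma tranclp_beta_seq:
  "beta\<^sup>+\<^sup>+ a a' \<Longrightarrow> beta\<^sup>+\<^sup>+ (seq a b) (seq a' b)"
  "beta\<^sup>+\<^sup>+ b b' \<Longrightarrow> beta\<^sup>+\<^sup>+ (seq a b) (seq a b')"
  by (auto simp: seq_def intro!: tranclp_beta_cong)

lemma rtranclp_beta_seq: "beta\<^sup>*\<^sup>* a a' \<Longrightarrow> beta\<^sup>*\<^sup>* (seq a b) (seq a' b)"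
  by (auto simp: seq_def intro!: rtranclp_beta_cong)

lemma seq_beta: "beta (seq a b) a"
  by (metis beta.intros(1) seq_def subst_lift)


section \<open>Monotonicity in the garbage and in the continuation\<close>

text \<open>Splits cuts in the same way as the equations of the translation: the clause for
  \<open>t (u::l)\<close> calls the translation of \<open>l\<close>, not of \<open>u::l\<close>.\<close>

lemma jmse_induct [case_names Var Lam Cmd Emp Push Sel Cut_Emp Cut_Push Cut_Sel]:
  assumes "\<And>i. P (Var i)" "\<And>t. P t \<Longrightarrow> P (Lam t)" "\<And>c. R c \<Longrightarrow> P (Cmd c)"
    and "Q Emp" "\<And>u l. P u \<Longrightarrow> Q l \<Longrightarrow> Q (Push u l)" "\<And>c. R c \<Longrightarrow> Q (Sel c)"
    and "\<And>t. P t \<Longrightarrow> R (Cut t Emp)"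
    and "\<And>t u l. P t \<Longrightarrow> P u \<Longrightarrow> Q l \<Longrightarrow> R (Cut t (Push u l))"
    and "\<And>t c. P t \<Longrightarrow> Q (Sel c) \<Longrightarrow> R (Cut t (Sel c))"
  shows "P t" "Q l" "R c"
proof -
  \<comment> \<open>The strengthened \<open>Q\<close> gives the case of
    \<open>Cut t (Push u l')\<close> access to \<open>P u\<close> and \<open>Q l'\<close>; plain
    induction yields only a hypothesis on \<open>Push u l'\<close>.\<close>
  have "P t" and "Q l \<and> (\<forall>u l'. l = Push u l' \<longrightarrow> P u \<and> Q l')" and "R c" for t l c
  proof (induction t and l and c)
    case (Cut t l)
    then show ?case by (cases l) (auto intro: assms)
  qed (auto intro: assms)
  then show "P t" "Q l" "R c" by blast+
qed

lemma trans_mono_K: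
  "beta\<^sup>+\<^sup>+ K K' \<Longrightarrow> beta\<^sup>+\<^sup>+ (trans_tm s t G K) (trans_tm s t G K')"
  "beta\<^sup>+\<^sup>+ K K' \<Longrightarrow> beta\<^sup>+\<^sup>+ (trans_cotm s l G K) (trans_cotm s l G K')"
  "beta\<^sup>+\<^sup>+ K K' \<Longrightarrow> beta\<^sup>+\<^sup>+ (trans_cmd s c G K) (trans_cmd s c G K')"
proof (induction t and l and c arbitrary: G K K' and G K K' and G K K' rule: jmse_induct)
  case (Sel c)
  then show ?case
    by (auto intro!: Sel.IH tranclp_beta_cong)
next
  case (Cut_Push t u l)
  then show ?case
    by (auto simp del: bar.simps intro!: Cut_Push.IH tranclp_beta_push_k)
next
  case (Cut_Sel t c)
  then show ?case
    by (simp del: bar.simps trans_cotm.simps add: tranclp_beta_cong)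
qed (auto intro!: tranclp_beta_cong tranclp_beta_push_k tranclp_beta_seq)

lemma trans_mono_G:
  "beta\<^sup>+\<^sup>+ G G' \<Longrightarrow> beta\<^sup>+\<^sup>+ (trans_tm s t G K) (trans_tm s t G' K)"
  "beta\<^sup>+\<^sup>+ G G' \<Longrightarrow> beta\<^sup>+\<^sup>+ (trans_cotm s l G K) (trans_cotm s l G' K)"
  "beta\<^sup>+\<^sup>+ G G' \<Longrightarrow> beta\<^sup>+\<^sup>+ (trans_cmd s c G K) (trans_cmd s c G' K)"
proof (induction t and l and c arbitrary: G G' K and G G' K and G G' K rule: jmse_induct)
  case (Cmd c)
  then show ?case
    by (auto intro!: Cmd.IH tranclp_beta_cong)
next
  case (Push u l)
  then have "beta\<^sup>+\<^sup>+ (lift 0 (push_k (trans_cotm s l G K) (bar s u)))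
      (lift 0 (push_k (trans_cotm s l G' K) (bar s u)))"
    by (intro tranclp_beta_cong tranclp_beta_push_k)
  with Push.prems show ?case
    unfolding trans_cotm.simps
    by (blast intro: tranclp_beta_cong tranclp_beta_LApp)
next
  case (Sel c)
  then show ?case
    by (auto intro!: Sel.IH tranclp_beta_cong)
next
  case (Cut_Sel t c)
  then show ?case
    by (simp del: bar.simps trans_cotm.simps add: tranclp_beta_cong)
next
  case (Cut_Push t u l)
  then show ?case
    \<comment> \<open>Here \<open>G\<close> also occurs in the continuation, through the translation
      of \<open>l\<close>; hence monotonicity in \<open>K\<close> comes first.\<close>
    by simp (meson trans_mono_K(1) tranclp_beta_push_k(1) tranclp_trans)
qed (auto intro!: tranclp_beta_cong tranclp_beta_seq)

lemma rtranclp_trans_tm_mono: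
  assumes "beta\<^sup>*\<^sup>* G G'" "beta\<^sup>*\<^sup>* K K'"
  shows "beta\<^sup>*\<^sup>* (trans_tm s t G K) (trans_tm s t G' K')"
  by (rule rtranclp_trans[OF rtranclp_map[OF trans_mono_G(1) assms(1)]
        rtranclp_map[OF trans_mono_K(1) assms(2)]])


section \<open>Lifting and substitution in translated expressions\<close>

lemma lift_trans:
  "closed_lam s \<Longrightarrow> lift k (trans_tm s t G K) = trans_tm s (lift_tm k t) (lift k G) (lift k K)"
  "closed_lam s \<Longrightarrow> lift k (trans_cotm s l G K) = trans_cotm s (lift_cotm k l) (lift k G) (lift k K)"
  "closed_lam s \<Longrightarrow> lift k (trans_cmd s c G K) = trans_cmd s (lift_cmd k c) (lift k G) (lift k K)"
  "closed_lam s \<Longrightarrow> lift k (bar s t) = bar s (lift_tm k t)"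
proof (induction s t G K and s l G K and s c G K and s t
    arbitrary: k and k and k and k
    rule: trans_tm_trans_cotm_trans_cmd_bar.induct)
  case (2 s t G K)
  show ?case
    by (simp add: lift_seq lift_lift del: bar.simps, simp add: "2.IH" "2.prems" del: bar.simps)
next
  case (5 s u l G K)
  show ?case
    by (simp add: lift_lift del: bar.simps,
        simp add: lift_push_k "5.IH" "5.prems" del: bar.simps)
next
  case (10 s t)
  then show ?case
    by (simp add: lift_lift_jmse)
qed (simp_all add: lift_push_k lift_lift del: bar.simps)

text \<open>A lifted expression does not mention index \<open>k\<close>, so \<open>v\<close> reaches
  only \<open>G\<close> and \<open>K\<close>. This computes the two contractions that feed a garbage
  term and a continuation to \<open>bar s t\<close>.\<close>

lemma subst_trans_lift:
  assumes "closed_lam s"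
  shows "subst k v (trans_tm s (lift_tm k t) G K) = trans_tm s t (subst k v G) (subst k v K)"
    "subst k v (trans_cotm s (lift_cotm k l) G K) = trans_cotm s l (subst k v G) (subst k v K)"
    "subst k v (trans_cmd s (lift_cmd k c) G K) = trans_cmd s c (subst k v G) (subst k v K)"
  using assms
  by (induction t and l and c arbitrary: k v G K and k v G K and k v G K rule: jmse_induct)
    (auto simp del: bar.simps simp: lift_trans(4)[symmetric] subst_seq subst_push_k
      lift_lift[symmetric] subst_lift_commute)

lemma bar_apply:
  assumes "closed_lam s"
  shows "beta\<^sup>+\<^sup>+ (LApp (LApp (bar s t) G) K) (trans_tm s t G K)"
proof -
  \<comment> \<open>The first contraction is for \<open>g\<close>, at index 1; the double lift of
    \<open>t\<close> is therefore read as a lift at 0 followed by one at 1.\<close>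
  have "beta (LApp (bar s t) G) (LAbs (trans_tm s (lift_tm 0 t) (lift 0 G) (LVar 0)))"
    using beta.intros(1)[of "LAbs (trans_tm s (lift_tm 0 (lift_tm 0 t)) (LVar 1) (LVar 0))" G]
      subst_trans_lift(1)[OF assms, of 1 "lift 0 G" "lift_tm 0 t" "LVar 1" "LVar 0"]
    by (simp add: lift_lift_jmse[of 0 0, simplified, symmetric])
  moreover have "beta (LApp (LAbs (trans_tm s (lift_tm 0 t) (lift 0 G) (LVar 0))) K)
      (trans_tm s t G K)"
    using beta.intros(1)[of "trans_tm s (lift_tm 0 t) (lift 0 G) (LVar 0)" K]
    by (simp add: subst_trans_lift[OF assms])
  ultimately show ?thesis
    by (meson beta.intros(2) tranclp.intros)
qed

text \<open>Equality fails only because of the replaced variable: \<open>x G\<^sup>+ K\<close>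
  becomes \<open>bar s v\<close> applied to two arguments, which must still be reduced.\<close>

lemma subst_trans:
  fixes s :: lam
  shows "\<lbrakk>closed_lam s; \<And>G. beta\<^sup>+\<^sup>+ (LApp s G) G\<rbrakk> \<Longrightarrow>
      beta\<^sup>*\<^sup>* (subst k (bar s v) (trans_tm s t G K))
        (trans_tm s (subst_tm k v t) (subst k (bar s v) G) (subst k (bar s v) K))"
    "\<lbrakk>closed_lam s; \<And>G. beta\<^sup>+\<^sup>+ (LApp s G) G\<rbrakk> \<Longrightarrow>
      beta\<^sup>*\<^sup>* (subst k (bar s v) (trans_cotm s l G K))
        (trans_cotm s (subst_cotm k v l) (subst k (bar s v) G) (subst k (bar s v) K))"
    "\<lbrakk>closed_lam s; \<And>G. beta\<^sup>+\<^sup>+ (LApp s G) G\<rbrakk> \<Longrightarrow>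
      beta\<^sup>*\<^sup>* (subst k (bar s v) (trans_cmd s c G K))
        (trans_cmd s (subst_cmd k v c) (subst k (bar s v) G) (subst k (bar s v) K))"
    "\<lbrakk>closed_lam s; \<And>G. beta\<^sup>+\<^sup>+ (LApp s G) G\<rbrakk> \<Longrightarrow>
      beta\<^sup>*\<^sup>* (subst k (bar s v) (bar s t)) (bar s (subst_tm k v t))"
proof (induction s t G K and s l G K and s c G K and s t
    arbitrary: k v and k v and k v and k v
    rule: trans_tm_trans_cotm_trans_cmd_bar.induct)
  case (1 s i G K)
  let ?G = "subst k (bar s v) G" and ?K = "subst k (bar s v) K"
  have "beta\<^sup>+\<^sup>+ (LApp (LApp (bar s v) (LApp s ?G)) ?K) (trans_tm s v ?G ?K)"
    using bar_apply[OF 1(1)] trans_mono_G(1)[OF 1(2)] by (meson tranclp_trans)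
  then show ?case
    using 1(1) by (auto simp del: bar.simps intro: tranclp_into_rtranclp)
next
  case (2 s t G K)
  have "beta\<^sup>*\<^sup>* (lift 1 (subst (Suc k) (lift 0 (bar s v)) (bar s t)))
      (lift 1 (bar s (subst_tm (Suc k) (lift_tm 0 v) t)))"
    unfolding lift_trans(4)[OF "2.prems"(1), of 0 v]
    by (rule rtranclp_beta_cong(4)) (rule "2.IH"[OF "2.prems"])
  then show ?case
    \<comment> \<open>Under \<open>w\<close> and \<open>x\<close> the term \<open>bar s v\<close> is
      lifted twice at 0, which equals a lift at 0 followed by one at 1, so the substitution commutes
      with the gap made for \<open>w\<close>.\<close>
    using subst_lift_commute[of 1 "Suc k" "lift 0 (bar s v)" "bar s t"]
    by (auto simp del: bar.simps simp: subst_seq lift_lift[of 0 0, simplified] intro!: rtranclp_beta_seq rtranclp_beta_cong)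
next
  case (5 s u l G K)
  then show ?case
    by (auto simp del: bar.simps simp: subst_push_k subst_lift_commute
      intro!: rtranclp_beta_cong rtranclp_beta_push_k)
next
  case (6 s c G K)
  have "beta\<^sup>*\<^sup>* (subst (Suc k) (lift 0 (bar s v)) (trans_cmd s c (lift 0 G) (lift 0 K)))
      (trans_cmd s (subst_cmd (Suc k) (lift_tm 0 v) c)
        (lift 0 (subst k (bar s v) G)) (lift 0 (subst k (bar s v) K)))"
    using "6.IH"[OF "6.prems", of "Suc k" "lift_tm 0 v"]
    by (simp add: subst_lift_commute lift_trans(4)[OF "6.prems"(1), symmetric] del: bar.simps)
  then show ?case
    by (simp add: rtranclp_beta_cong del: bar.simps)
next
  case (8 s t u l G K)
  have "beta\<^sup>*\<^sup>* (subst k (bar s v) (push_k (trans_cotm s l G K) (bar s u)))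
      (push_k (trans_cotm s (subst_cotm k v l) (subst k (bar s v) G) (subst k (bar s v) K))
        (bar s (subst_tm k v u)))"
    unfolding subst_push_k using "8.IH"(1,2)[OF "8.prems"] by (rule rtranclp_beta_push_k)
  \<comment> \<open>The hypothesis for \<open>t\<close> leaves the substitution in the continuation,
    where monotonicity finishes the reduction.\<close>
  then show ?case
    unfolding trans_cmd.simps subst_cmd.simps subst_cotm.simps
    by (rule rtranclp_trans[OF "8.IH"(3)[OF "8.prems"]
          rtranclp_trans_tm_mono[OF rtranclp.rtrancl_refl]])
next
  case (9 s t c G K)
  then show ?case
    by (auto simp del: bar.simps intro!: rtranclp_beta_LApp)
next
  case (10 s t)
  have "beta\<^sup>*\<^sup>* (subst (Suc (Suc k)) (bar s (lift_tm 0 (lift_tm 0 v)))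
      (trans_tm s (lift_tm 0 (lift_tm 0 t)) (LVar 1) (LVar 0)))
    (trans_tm s (lift_tm 0 (lift_tm 0 (subst_tm k v t))) (LVar 1) (LVar 0))"
    using "10.IH"[OF "10.prems", of "Suc (Suc k)" "lift_tm 0 (lift_tm 0 v)"]
    by (simp add: subst_lift_commute_jmse del: bar.simps)
  then show ?case
    using "10.prems"(1)
    by (simp add: bar.simps[of s t] bar.simps[of s "subst_tm k v t"] lift_trans(4) rtranclp_beta_cong
        del: bar.simps)
qed (auto simp del: bar.simps simp: subst_lift_commute)


section \<open>Simulation\<close>

text \<open>The continuation that an evaluation context builds on top of \<open>K\<close>. The value
  on \<open>Sel\<close> is a default.\<close>

fun context_k :: "lam \<Rightarrow> cotm \<Rightarrow> lam \<Rightarrow> lam \<Rightarrow> lam" where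
  "context_k s (Push u l) G K = push_k (trans_cotm s l G K) (bar s u)"
| "context_k s _ G K = K"

lemma lift_context_k:
  "closed_lam s \<Longrightarrow>
    lift k (context_k s E G K) = context_k s (lift_cotm k E) (lift k G) (lift k K)"
  by (cases E) (auto simp: lift_push_k lift_trans simp del: bar.simps)

lemma trans_cmd_eval_context:
  "eval_context E \<Longrightarrow> trans_cmd s (Cut t E) G K = trans_tm s t G (context_k s E G K)"
  by (cases E) (auto simp del: bar.simps)

text \<open>Appending \<open>E\<close> changes only the continuation, since \<open>[]\<close> and
  \<open>u::l\<close> are both translated to the shape \<open>\<lambda>w. w G K'\<close>. The
  conjuncts need each other: \<open>Sel\<close> uses the one on cuts, a cut with \<open>Push\<close>
  the one on co-terms.\<close>

lemma trans_append:
  assumes "closed_lam s" "eval_context E"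
  shows "trans_cotm s (append_cotm l E) G K = trans_cotm s l G (context_k s E G K)
    \<and> (\<forall>t. trans_cmd s (Cut t (append_cotm l E)) G K = trans_cmd s (Cut t l) G (context_k s E G K))"
  using assms(2)
proof (induction l E arbitrary: G K rule: append_cotm.induct)
  case (1 E)
  then show ?case by (cases E) (auto simp del: bar.simps)
qed (auto simp: lift_context_k assms(1) simp del: bar.simps)

text \<open>An evaluation context passes \<open>G\<close> and its continuation to
  \<open>bar s t\<close>; for \<open>(x)c\<close> both sides are the same term.\<close>

lemma trans_cotm_apply_bar:
  assumes "closed_lam s"
  shows "beta\<^sup>*\<^sup>* (LApp (trans_cotm s l G K) (bar s t)) (trans_cmd s (Cut t l) G K)"
proof (cases "eval_context l")
  case True
  have "beta (LApp (trans_cotm s l G K) (bar s t)) (LApp (LApp (bar s t) G) (context_k s l G K))"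
    using True beta.intros(1)[of "LApp (LApp (LVar 0) (lift 0 G)) (lift 0 (context_k s l G K))" "bar s t"]
    by (cases l) (auto simp del: bar.simps)
  then show ?thesis
    using bar_apply[OF assms, of t G "context_k s l G K"] True
    by (simp add: trans_cmd_eval_context del: bar.simps)
next
  case False
  then show ?thesis by (cases l) (auto simp del: bar.simps)
qed

section \<open>The rules \<open>sigma\<close>, \<open>beta\<close>, \<open>pi\<close> and
  \<open>mu\<close> at the root\<close>

lemma trans_sigma:
  assumes "closed_lam s" "\<And>G. beta\<^sup>+\<^sup>+ (LApp s G) G"
  shows "beta\<^sup>+\<^sup>+ (trans_cmd s (Cut t (Sel c)) G K) (trans_cmd s (subst_cmd 0 t c) G K)"
proof -
  have "beta (trans_cmd s (Cut t (Sel c)) G K)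
      (subst 0 (bar s t) (trans_cmd s c (lift 0 G) (lift 0 K)))"
    by (simp add: beta.intros del: bar.simps)
  then show ?thesis
    using subst_trans(3)[OF assms, of 0 t c "lift 0 G" "lift 0 K"]
    by (simp del: bar.simps trans_cmd.simps)
qed

text \<open>The garbage is discarded, \<open>push_k\<close> hands over the translations of
  \<open>l\<close> and \<open>u\<close>, \<open>w\<close> receives the former, and under
  \<open>x\<close> it meets \<open>bar s t\<close>. The argument \<open>bar s u\<close> stays
  unsubstituted, as in the translation of the reduct.\<close>

lemma trans_beta:
  assumes "closed_lam s"
  shows "beta\<^sup>+\<^sup>+ (trans_cmd s (Cut (Lam t) (Push u l)) G K)
    (trans_cmd s (Cut u (Sel (Cut t (lift_cotm 0 l)))) G K)"
proof -
  let ?L = "trans_cotm s l G K"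
  let ?F = "LAbs (LAbs (LApp (LVar 1) (lift 1 (bar s t))))"
  have "beta\<^sup>+\<^sup>+ (trans_cmd s (Cut (Lam t) (Push u l)) G K) (LApp (push_k ?L (bar s u)) ?F)"
    by (simp add: seq_beta tranclp.r_into_trancl del: bar.simps)
  also have "beta\<^sup>+\<^sup>+ \<dots> (LApp (LApp ?F ?L) (bar s u))"
    using beta.intros(1)[of "LApp (LApp (LVar 0) (lift 0 ?L)) (lift 0 (bar s u))" ?F]
    by (simp add: push_k_def del: bar.simps)
  also have "beta\<^sup>+\<^sup>+ \<dots> (LApp (LAbs (LApp (lift 0 ?L) (bar s t))) (bar s u))"
    using beta.intros(1)[of "LAbs (LApp (LVar 1) (lift 1 (bar s t)))" ?L]
    by (intro tranclp.r_into_trancl beta.intros(2)) (simp del: bar.simps)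
  also have "beta\<^sup>*\<^sup>* \<dots> (trans_cmd s (Cut u (Sel (Cut t (lift_cotm 0 l)))) G K)"
    using trans_cotm_apply_bar[OF assms, of "lift_cotm 0 l" "lift 0 G" "lift 0 K" t]
    by (simp add: lift_trans assms rtranclp_beta_cong del: bar.simps)
  finally show ?thesis .
qed

text \<open>Both sides are the translation of \<open>t l\<close> with continuation
  \<open>context_k s E G K\<close>; only the garbage differs, \<open>G\<^sup>+\<close> against
  \<open>G\<close>.\<close>

lemma trans_pi:
  assumes "closed_lam s" "\<And>G. beta\<^sup>+\<^sup>+ (LApp s G) G" "eval_context E"
  shows "beta\<^sup>+\<^sup>+ (trans_cmd s (Cut (Cmd (Cut t l)) E) G K)
    (trans_cmd s (Cut t (append_cotm l E)) G K)"
  using trans_mono_G(3)[OF assms(2), of s "Cut t l" G "context_k s E G K"] assms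
  by (simp add: trans_append trans_cmd_eval_context)

lemma trans_mu:
  assumes "closed_lam s" "\<And>G. beta\<^sup>+\<^sup>+ (LApp s G) G"
  shows "beta\<^sup>+\<^sup>+ (trans_cotm s (Sel (Cut (Var 0) (lift_cotm 0 l))) G K) (trans_cotm s l G K)"
proof (cases "eval_context l")
  case True
  \<comment> \<open>The left side has this same form with \<open>G\<^sup>+\<close> for
    \<open>G\<close>.\<close>
  have "trans_cotm s l G K = LAbs (LApp (LApp (LVar 0) (lift 0 G)) (lift 0 (context_k s l G K)))"
    using True by (cases l) (auto simp del: bar.simps)
  then show ?thesis
    using True assms
    by (simp add: trans_cmd_eval_context lift_context_k tranclp_beta_cong)
next
  case False
  then obtain c where l: "l = Sel c" by (cases l) auto
  show ?thesis
    using trans_sigma[OF assms, of "Var 0" "lift_cmd 1 c" "lift 0 G" "lift 0 K"]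
    by (simp add: l subst_Var_lift tranclp_beta_cong del: bar.simps trans_cmd.simps)
qed

text \<open>The induction follows the translation, since a step inside \<open>u::l\<close> in a cut
  needs hypotheses on \<open>u\<close> and \<open>l\<close>; induction on the step would offer one
  on \<open>u::l\<close>.\<close>

lemma trans_red:
  fixes s :: lam
  shows "\<lbrakk>closed_lam s; \<And>G. beta\<^sup>+\<^sup>+ (LApp s G) G; red_tm t t'\<rbrakk> \<Longrightarrow>
      beta\<^sup>+\<^sup>+ (trans_tm s t G K) (trans_tm s t' G K)"
    "\<lbrakk>closed_lam s; \<And>G. beta\<^sup>+\<^sup>+ (LApp s G) G; red_cotm l l'\<rbrakk> \<Longrightarrow>
      beta\<^sup>+\<^sup>+ (trans_cotm s l G K) (trans_cotm s l' G K)"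
    "\<lbrakk>closed_lam s; \<And>G. beta\<^sup>+\<^sup>+ (LApp s G) G; red_cmd c c'\<rbrakk> \<Longrightarrow>
      beta\<^sup>+\<^sup>+ (trans_cmd s c G K) (trans_cmd s c' G K)"
    "\<lbrakk>closed_lam s; \<And>G. beta\<^sup>+\<^sup>+ (LApp s G) G; red_tm t t'\<rbrakk> \<Longrightarrow>
      beta\<^sup>+\<^sup>+ (bar s t) (bar s t')"
proof (induction s t G K and s l G K and s c G K and s t
    arbitrary: t' and l' and c' and t'
    rule: trans_tm_trans_cotm_trans_cmd_bar.induct)
  case (1 s i G K)
  from 1(3) show ?case by cases
next
  case (2 s t G K)
  from 2(4) show ?case
    by cases (use 2 in \<open>auto simp del: bar.simps intro!: tranclp_beta_seq tranclp_beta_cong\<close>)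
next
  case (3 s c G K)
  from 3(4) show ?case
    by cases (use 3 in \<open>auto intro: trans_mono_G\<close>)
next
  case (4 s G K)
  from 4(3) show ?case by cases
next
  case (5 s u l G K)
  from 5(5) show ?case
    by cases (use 5 in \<open>auto simp del: bar.simps intro!: tranclp_beta_cong tranclp_beta_push_k\<close>)
next
  case (6 s c G K)
  from 6(4) show ?case
  proof cases
    case mu
    then show ?thesis using trans_mu[OF 6(2,3)] by (simp del: trans_cotm.simps)
  qed (use 6 in \<open>auto intro!: tranclp_beta_cong\<close>)
next
  case (7 s t G K)
  from 7(4) show ?case
  proof cases
    case (pi t l)
    then show ?thesis using trans_pi[OF 7(2,3)] by (simp del: trans_cmd.simps)
  next
    case (Cut2 l')
    from this(2) show ?thesis by cases
  qed (use 7 in auto)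
next
  case (8 s t u l G K)
  from 8(6) show ?case
  proof cases
    case (beta t)
    then show ?thesis using trans_beta[OF 8(4)] by (simp del: trans_cmd.simps)
  next
    case (pi t l)
    then show ?thesis using trans_pi[OF 8(4,5)] by (simp del: trans_cmd.simps)
  next
    \<comment> \<open>The reduct is again a \<open>Push\<close>, so only the continuation of
      \<open>t\<close> changes.\<close>
    case (Cut2 l')
    from this(2) show ?thesis
      by cases (use 8 Cut2(1) in
        \<open>auto simp del: bar.simps intro!: trans_mono_K tranclp_beta_push_k\<close>)
  qed (use 8 in \<open>auto simp del: bar.simps\<close>)
next
  case (9 s t c G K)
  from 9(5) show ?case
  proof cases
    case sigma
    then show ?thesis using trans_sigma[OF 9(3,4)] by (simp del: trans_cmd.simps)
  next
    case (Cut2 l')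
    have "beta\<^sup>+\<^sup>+ (trans_cmd s (Cut t (Sel c)) G K) (LApp (trans_cotm s l' G K) (bar s t))"
      using 9 Cut2 by (simp add: tranclp_beta_cong del: bar.simps trans_cotm.simps)
    then show ?thesis
      using trans_cotm_apply_bar[OF 9(3), of l' G K t] Cut2(1)
      by (simp del: bar.simps trans_cotm.simps trans_cmd.simps)
  qed (use 9 in \<open>auto simp del: bar.simps intro!: tranclp_beta_cong\<close>)
next
  case (10 s t)
  show ?case
    unfolding bar.simps
    using "10.IH"[OF "10.prems"(1,2) red_lift(1)[OF red_lift(1)[OF "10.prems"(3)]]]
    by (intro tranclp_beta_cong(3))
qed

theorem theorem4p3:
  fixes s :: lam and t u :: tm
  assumes "closed_lam s"
    and "\<And>G. beta\<^sup>+\<^sup>+ (LApp s G) G"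
    and "red_tm t u"
  shows "beta\<^sup>+\<^sup>+ (bar s t) (bar s u)"
  using assms by (rule trans_red(4))

end
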